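(* Let $G$ be a partizan Kayles position (a disjunctive sum of strips) containing $x$ strips whose length is congruent to $1$ modulo $3$ and $y$ strips whose length is congruent to $2$ modulo $3$. Then the misère outcome of $G$ is $$o^-(G)=\begin{cases}\mathcal{N}, & \text{if } x=y, \text{ or if } x<y \text{ and } x+2y\equiv 0 \pmod 3,\\ \mathcal{R}, & \text{if } x>y, \text{ or if } x<y \text{ and } x+2y\equiv 1 \pmod 3,\\ \mathcal{P}, & \text{if } x<y \text{ and } x+2y\equiv 2\pmod 3.\end{cases}$$
   Context: Partizan Kayles is played on $1\times n$ strips of squares; $S_n$ denotes an empty strip of length $n$. Left moves by placing a single square on one empty cell; Right moves by placing a domino covering two adjacent empty cells of the same strip; a placement splits a strip into the strips of empty cells on either side, so positions are disjunctive sums of strips. Under misère play a player unable to move on their turn wins. The outcome is $\mathcal{L}$ (Left wins moving first or second), $\mathcal{R}$ (Right wins moving first or second), $\mathcal{N}$ (the first player wins) or $\mathcal{P}$ (the second player wins). *)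

theory Defs
  imports "HOL-Library.Multiset" "HOL-Number_Theory.Cong"
begin

datatype player = Left | Right

fun piece_length :: "player \<Rightarrow> nat" where
  "piece_length Left = 1"
| "piece_length Right = 2"

text \<open>A position is the multiset of the lengths of its strips; the summand \<open>n\<close> is the
  empty strip \<open>S\<^sub>n\<close>. Strips of length 0 are allowed. Placing a piece leaves
  \<open>a\<close> empty cells on one side of it and \<open>b\<close> on the other.\<close>

type_synonym position = "nat multiset"

definition kayles_moves :: "player \<Rightarrow> position \<Rightarrow> position set" where
  "kayles_moves p G =
     {G - {#n#} + {#a, b#} | n a b. n \<in># G \<and> n = a + piece_length p + b}"

fun opponent :: "player \<Rightarrow> player" where
  "opponent Left = Right"
| "opponent Right = Left"

lemma sum_mset_kayles_moves:
  assumes "H \<in> kayles_moves p G"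
  shows "sum_mset H < sum_mset G"
proof -
  obtain n a b where n: "n \<in># G" "n = a + piece_length p + b"
    and H: "H = G - {#n#} + {#a, b#}"
    using assms unfolding kayles_moves_def by blast
  obtain K where "G = add_mset n K"
    using n(1) by (metis insert_DiffM)
  then show ?thesis
    using n(2) H by (cases p) auto
qed

text \<open>\<open>misere_wins w m G\<close>: player \<open>w\<close> has a winning strategy under misere
  play on \<open>G\<close> when player \<open>m\<close> is to move.\<close>

function misere_wins :: "player \<Rightarrow> player \<Rightarrow> position \<Rightarrow> bool" where
  "misere_wins w m G =
     (if kayles_moves m G = {} then w = m
      else if w = m then \<exists>H \<in> kayles_moves m G. misere_wins w (opponent m) H
      else \<forall>H \<in> kayles_moves m G. misere_wins w (opponent m) H)"
  by pat_completeness auto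
termination
  by (relation "Wellfounded.measure (\<lambda>(w, m, G). sum_mset G)")
     (auto simp: sum_mset_kayles_moves)

declare misere_wins.simps [simp del]

lemma misere_wins_opponent:
  "misere_wins (opponent w) m G \<longleftrightarrow> \<not> misere_wins w m G"
proof (induction w m G rule: misere_wins.induct)
  case (1 w m G)
  have neq: "opponent w = m \<longleftrightarrow> w \<noteq> m"
    by (cases w; cases m) auto
  show ?case
    using 1 neq
    by (subst (1 2) misere_wins.simps) (auto split: if_splits)
qed

datatype outcome = \<L> | \<R> | \<N> | \<P>

definition misere_outcome :: "position \<Rightarrow> outcome" where
  "misere_outcome G =
     (if misere_wins Left Left G \<and> misere_wins Left Right G then \<L>
      else if misere_wins Right Left G \<and> misere_wins Right Right G then \<R>
      else if misere_wins Left Left G \<and> misere_wins Right Right G then \<N>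
      else \<P>)"

lemma misere_outcome_iff:
  "misere_outcome G = \<L> \<longleftrightarrow> misere_wins Left Left G \<and> misere_wins Left Right G"
  "misere_outcome G = \<R> \<longleftrightarrow> misere_wins Right Left G \<and> misere_wins Right Right G"
  "misere_outcome G = \<N> \<longleftrightarrow> misere_wins Left Left G \<and> misere_wins Right Right G"
  "misere_outcome G = \<P> \<longleftrightarrow> misere_wins Right Left G \<and> misere_wins Left Right G"
  using misere_wins_opponent[of Left Left G] misere_wins_opponent[of Left Right G]
  by (auto simp: misere_outcome_def)

end

theory Submission
  imports Defs
begin

text \<open>
  The outcome depends only on the excess \<open>d = x - y\<close>. Every Left move changes \<open>d\<close> by \<open>-1\<close> or
  \<open>+2\<close> and every Right move by \<open>+1\<close> or \<open>-2\<close>, so \<open>d\<close> modulo 3 evolves independently of the play.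
  Left wins moving first iff \<open>d \<le> 0\<close> and \<open>d \<equiv> 0\<close>, and moving second iff \<open>d < 0\<close> and \<open>d \<equiv> 2\<close>
  (modulo 3). The sign of \<open>d\<close> matters only in the right residue class: there Right wants to play \<open>+1\<close>,
  which is available whenever Right can move at all, and Left wants to play \<open>-1\<close>, which is available
  unless all nonempty strips have length 2, in which case \<open>d \<le> -3\<close> and \<open>+2\<close> is good enough.
\<close>

text \<open>The representative of \<open>n\<close> modulo 3 in {-1, 0, 1}. So the excess of a
  position is congruent modulo 3 to its number of empty cells.\<close>

definition strip_excess :: "nat \<Rightarrow> int" where
  "strip_excess n = (if n mod 3 = 1 then 1 else if n mod 3 = 2 then -1 else 0)"

definition excess :: "position \<Rightarrow> int" where
  "excess G = (\<Sum>n\<in>#G. strip_excess n)"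

lemma excess_eq_size_diff:
  "excess G = int (size {#n \<in># G. [n = 1] (mod 3)#}) - int (size {#n \<in># G. [n = 2] (mod 3)#})"
  by (induction G) (auto simp: excess_def strip_excess_def cong_def)

lemma mod_3_cases:
  fixes n :: nat
  obtains "n mod 3 = 0" | "n mod 3 = 1" | "n mod 3 = 2"
  by linarith

lemma excess_move:
  assumes "n \<in># G"
  shows "excess (G - {#n#} + {#a, b#}) = excess G - strip_excess n + strip_excess a + strip_excess b"
proof -
  obtain K where "G = add_mset n K"
    using assms by (metis insert_DiffM)
  then show ?thesis
    by (simp add: excess_def)
qed

lemma kayles_moveI:
  assumes "n \<in># G" "n = a + piece_length p + b"
    and "strip_excess a + strip_excess b = strip_excess n + c"
  shows "\<exists>H \<in> kayles_moves p G. excess H = excess G + c"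
proof
  show "G - {#n#} + {#a, b#} \<in> kayles_moves p G"
    using assms unfolding kayles_moves_def by blast
  show "excess (G - {#n#} + {#a, b#}) = excess G + c"
    using assms excess_move[of n G a b] by simp
qed

text \<open>One cell is lost, so the difference is -1 modulo 3; as three terms from {-1, 0, 1}, it
  lies between -3 and 3, which leaves -1 and 2.\<close>

lemma left_split_strip_excess:
  "strip_excess a + strip_excess b - strip_excess (a + 1 + b) \<in> {-1, 2}"
proof -
  have "(a + 1 + b) mod 3 = (a mod 3 + 1 + b mod 3) mod 3"
    by (intro mod_add_cong) simp_all
  then show ?thesis
    unfolding strip_excess_def
    by (cases a rule: mod_3_cases; cases b rule: mod_3_cases) simp_all
qed

lemma right_split_strip_excess:
  "strip_excess a + strip_excess b - strip_excess (a + 2 + b) \<in> {1, -2}"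
proof -
  have "(a + 2 + b) mod 3 = (a mod 3 + 2 + b mod 3) mod 3"
    by (intro mod_add_cong) simp_all
  then show ?thesis
    unfolding strip_excess_def
    by (cases a rule: mod_3_cases; cases b rule: mod_3_cases) simp_all
qed

lemma excess_left_move:
  assumes "H \<in> kayles_moves Left G"
  shows "excess H = excess G - 1 \<or> excess H = excess G + 2"
proof -
  obtain a b where n: "a + 1 + b \<in># G" and H: "H = G - {#a + 1 + b#} + {#a, b#}"
    using assms unfolding kayles_moves_def by auto
  show ?thesis
    using excess_move[OF n, of a b] H left_split_strip_excess[of a b] by auto
qed

lemma excess_right_move:
  assumes "H \<in> kayles_moves Right G"
  shows "excess H = excess G + 1 \<or> excess H = excess G - 2"
proof -
  obtain a b where n: "a + 2 + b \<in># G" and H: "H = G - {#a + 2 + b#} + {#a, b#}"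
    using assms unfolding kayles_moves_def by auto
  show ?thesis
    using excess_move[OF n, of a b] H right_split_strip_excess[of a b] by auto
qed

lemma kayles_moves_empty_iff:
  "kayles_moves p G = {} \<longleftrightarrow> (\<forall>n \<in># G. n < piece_length p)"
proof
  assume "kayles_moves p G = {}"
  then have no: "n \<noteq> a + piece_length p + b" if "n \<in># G" for n a b
    using that unfolding kayles_moves_def by blast
  show "\<forall>n \<in># G. n < piece_length p"
  proof
    fix n assume "n \<in># G"
    then show "n < piece_length p"
      using no[of n 0 "n - piece_length p"] by simp
  qed
qed (auto simp: kayles_moves_def)

text \<open>Strips of length 0 and 1 never contribute -1. A stuck Right wins, matching the failure
  of Left's criterion \<open>excess G < 0\<close>.\<close>

lemma excess_nonneg_if_no_right_move:
  assumes "kayles_moves Right G = {}"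
  shows "excess G \<ge> 0"
proof -
  have "\<forall>n \<in># G. n < 2"
    using assms by (simp add: kayles_moves_empty_iff)
  then show ?thesis
    by (induction G) (auto simp: excess_def strip_excess_def)
qed

lemma excess_zero_if_no_left_move:
  assumes "kayles_moves Left G = {}"
  shows "excess G = 0"
proof -
  have "\<forall>n \<in># G. n = 0"
    using assms by (simp add: kayles_moves_empty_iff)
  then show ?thesis
    by (induction G) (auto simp: excess_def strip_excess_def)
qed

lemma strip_excess_add_mult: "strip_excess (3 * k + n) = strip_excess n"
  by (simp add: strip_excess_def)

lemma strip_excess_small:
  "strip_excess 0 = 0" "strip_excess (Suc 0) = 1" "strip_excess 2 = -1"
  "strip_excess 3 = 0" "strip_excess 4 = 1" "strip_excess 5 = -1"
  by (simp_all add: strip_excess_def)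

lemma right_increment_move:
  assumes "kayles_moves Right G \<noteq> {}"
  shows "\<exists>H \<in> kayles_moves Right G. excess H = excess G + 1"
proof -
  obtain n where n: "n \<in># G" "n \<ge> 2"
    using assms by (auto simp: kayles_moves_empty_iff not_less)
  \<comment> \<open>Residue 1 starts at 4, since a strip of length 1 has no room for a
    domino.\<close>
  have "\<exists>j. n = 3 * j + 2 \<or> n = 3 * j + 3 \<or> n = 3 * j + 4"
    using n(2) by presburger
  then consider j where "n = 3 * j + 2" | j where "n = 3 * j + 3" | j where "n = 3 * j + 4"
    by blast
  then show ?thesis
  proof cases
    case (1 j)
    then have "\<exists>H \<in> kayles_moves Right G. excess H = excess G + 1"
      using n(1) strip_excess_add_mult[of j "0"] strip_excess_add_mult[of j "2"]
      by (intro kayles_moveI[of n G 0 Right "3 * j + 0"]) (simp_all add: strip_excess_small)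
    then show ?thesis
      by simp
  next
    case (2 j)
    then have "\<exists>H \<in> kayles_moves Right G. excess H = excess G + 1"
      using n(1) strip_excess_add_mult[of j "1"] strip_excess_add_mult[of j "3"]
      by (intro kayles_moveI[of n G 0 Right "3 * j + 1"]) (simp_all add: strip_excess_small)
    then show ?thesis
      by simp
  next
    case (3 j)
    then have "\<exists>H \<in> kayles_moves Right G. excess H = excess G + 1"
      using n(1) strip_excess_add_mult[of j "1"] strip_excess_add_mult[of j "4"]
      \<comment> \<open>A domino at the end would change the excess by -2; leaving one cell beside
        it makes both parts contribute 1.\<close>
      by (intro kayles_moveI[of n G 1 Right "3 * j + 1"]) (simp_all add: strip_excess_small)
    then show ?thesis
      by simp
  qed
qed

text \<open>Length 2 is excluded because its only split, into 0 and 1, raises the excess by 2.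
  Longer strips of residue 2 split into 2 and \<open>3 * j + 2\<close>; the other residues allow a
  square at the end.\<close>

lemma left_decrement_move:
  assumes "n \<in># G" "n \<noteq> 0" "n \<noteq> 2"
  shows "\<exists>H \<in> kayles_moves Left G. excess H = excess G - 1"
proof -
  have "\<exists>j. n = 3 * j + 1 \<or> n = 3 * j + 3 \<or> n = 3 * j + 5"
    using assms(2,3) by presburger
  then consider j where "n = 3 * j + 1" | j where "n = 3 * j + 3" | j where "n = 3 * j + 5"
    by blast
  then show ?thesis
  proof cases
    case (1 j)
    then have "\<exists>H \<in> kayles_moves Left G. excess H = excess G + (-1)"
      using assms(1) strip_excess_add_mult[of j "0"] strip_excess_add_mult[of j "1"]
      by (intro kayles_moveI[of n G 0 Left "3 * j + 0"]) (simp_all add: strip_excess_small)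
    then show ?thesis
      by simp
  next
    case (2 j)
    then have "\<exists>H \<in> kayles_moves Left G. excess H = excess G + (-1)"
      using assms(1) strip_excess_add_mult[of j "2"] strip_excess_add_mult[of j "3"]
      by (intro kayles_moveI[of n G 0 Left "3 * j + 2"]) (simp_all add: strip_excess_small)
    then show ?thesis
      by simp
  next
    case (3 j)
    then have "\<exists>H \<in> kayles_moves Left G. excess H = excess G + (-1)"
      using assms(1) strip_excess_add_mult[of j "2"] strip_excess_add_mult[of j "5"]
      by (intro kayles_moveI[of n G 2 Left "3 * j + 2"]) (simp_all add: strip_excess_small)
    then show ?thesis
      by simp
  qed
qed

lemma left_winning_move:
  assumes "kayles_moves Left G \<noteq> {}" "excess G \<le> 0" "excess G mod 3 = 0"
  shows "\<exists>H \<in> kayles_moves Left G. excess H < 0 \<and> excess H mod 3 = 2"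
proof (cases "\<exists>n \<in># G. n \<noteq> 0 \<and> n \<noteq> 2")
  case True
  then obtain n where "n \<in># G" "n \<noteq> 0" "n \<noteq> 2"
    by blast
  then obtain H where "H \<in> kayles_moves Left G" "excess H = excess G - 1"
    using left_decrement_move by blast
  moreover have "excess H < 0 \<and> excess H mod 3 = 2"
    using assms(2,3) \<open>excess H = excess G - 1\<close> by presburger
  ultimately show ?thesis
    by blast
next
  case False
  obtain H where H: "H \<in> kayles_moves Left G"
    using assms(1) by blast
  obtain n where n: "n \<in># G" "n \<noteq> 0"
    using assms(1) by (auto simp: kayles_moves_empty_iff)
  have nonpos: "excess K \<le> 0" if "\<forall>n \<in># K. n = 0 \<or> n = 2" for K
    using that by (induction K) (auto simp: excess_def strip_excess_def)
  obtain K where K: "G = add_mset 2 K"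
    using n False by (metis insert_DiffM)
  then have "excess G = excess K - 1"
    by (simp add: excess_def strip_excess_def)
  \<comment> \<open>The strip of length 2 gives excess at most -1, and divisibility by 3 pushes it
    to -3. Hence any Left move, even one adding 2, stays negative.\<close>
  then have "excess G \<le> -3"
    using nonpos[of K] False K assms(3) by auto presburger
  then have "excess H < 0 \<and> excess H mod 3 = 2"
    using excess_left_move[OF H] assms(3) by presburger
  then show ?thesis
    using H by blast
qed

text \<open>Both claims are proved in one induction on the number of empty cells, since each move
  hands the turn to the other player.\<close>

lemma misere_wins_Left_iff:
  "misere_wins Left Left G \<longleftrightarrow> excess G \<le> 0 \<and> excess G mod 3 = 0"
  "misere_wins Left Right G \<longleftrightarrow> excess G < 0 \<and> excess G mod 3 = 2"
proof (induction "sum_mset G" arbitrary: G rule: less_induct)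
  case less
  have IH_R: "misere_wins Left Right H \<longleftrightarrow> excess H < 0 \<and> excess H mod 3 = 2"
    if "H \<in> kayles_moves Left G" for H
    using less[OF sum_mset_kayles_moves[OF that]] by blast
  have IH_L: "misere_wins Left Left H \<longleftrightarrow> excess H \<le> 0 \<and> excess H mod 3 = 0"
    if "H \<in> kayles_moves Right G" for H
    using less[OF sum_mset_kayles_moves[OF that]] by blast
  {
    case 1
    \<comment> \<open>Undoing a Left move adds 1 or subtracts 2, so a negative excess becomes at
      most 0.\<close>
    have "excess G \<le> 0 \<and> excess G mod 3 = 0"
      if "H \<in> kayles_moves Left G" "excess H < 0 \<and> excess H mod 3 = 2" for H
      using excess_left_move[OF that(1)] that(2) by presburger
    then have "excess G \<le> 0 \<and> excess G mod 3 = 0 \<longleftrightarrow>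
        (\<exists>H \<in> kayles_moves Left G. excess H < 0 \<and> excess H mod 3 = 2)"
      if "kayles_moves Left G \<noteq> {}"
      using left_winning_move[OF that] by metis
    then show ?case
      using IH_R excess_zero_if_no_left_move[of G]
      by (subst misere_wins.simps) simp
  next
    case 2
    have *: "excess H \<le> 0 \<and> excess H mod 3 = 0"
      if "H \<in> kayles_moves Right G" "excess G < 0 \<and> excess G mod 3 = 2" for H
      using excess_right_move[OF that(1)] that(2) by presburger
    have "excess G < 0 \<and> excess G mod 3 = 2"
      if ne: "kayles_moves Right G \<noteq> {}"
        and all: "\<forall>H \<in> kayles_moves Right G. excess H \<le> 0 \<and> excess H mod 3 = 0"
    proof -
      \<comment> \<open>The increment is Right's best reply: testing the hypothesis on it alone
        recovers both the sign and the residue of \<open>excess G\<close>.\<close>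
      obtain H where "H \<in> kayles_moves Right G" "excess H = excess G + 1"
        using right_increment_move[OF ne] by blast
      then have "excess G + 1 \<le> 0 \<and> (excess G + 1) mod 3 = 0"
        using all by metis
      then show ?thesis
        by presburger
    qed
    then have "excess G < 0 \<and> excess G mod 3 = 2 \<longleftrightarrow>
        (\<forall>H \<in> kayles_moves Right G. excess H \<le> 0 \<and> excess H mod 3 = 0)"
      if "kayles_moves Right G \<noteq> {}"
      using * that by metis
    then show ?case
      using IH_L excess_nonneg_if_no_right_move[of G]
      by (subst misere_wins.simps) simp
  }
qed

theorem theorem4p4:
  fixes G :: position and x y :: nat
  assumes "x = size {#n \<in># G. [n = 1] (mod 3)#}"
    and "y = size {#n \<in># G. [n = 2] (mod 3)#}"
  shows "(x = y \<or> (x < y \<and> [x + 2 * y = 0] (mod 3)) \<longrightarrow> misere_outcome G = \<N>) \<and>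
         (x > y \<or> (x < y \<and> [x + 2 * y = 1] (mod 3)) \<longrightarrow> misere_outcome G = \<R>) \<and>
         (x < y \<and> [x + 2 * y = 2] (mod 3) \<longrightarrow> misere_outcome G = \<P>)"
proof -
  have d: "excess G = int x - int y"
    using assms excess_eq_size_diff by simp
  have R: "misere_wins Right m G \<longleftrightarrow> \<not> misere_wins Left m G" for m
    using misere_wins_opponent[of Left m G] by simp
  \<comment> \<open>Passes from the residue of the excess to that of \<open>x + 2 * y\<close>, the
    form used in the statement.\<close>
  have "int (x + 2 * y) = int x - int y + 3 * int y"
    by simp
  then have "(int x - int y) mod 3 = int ((x + 2 * y) mod 3)"
    by (metis mod_mult_self2 of_nat_mod of_nat_numeral)
  then show ?thesis
    unfolding misere_outcome_iff R misere_wins_Left_iff d cong_def by auto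
qed

end
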